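(* Let $\mathbb{F}$ be a field of characteristic zero, let $A,B\in M_k(\mathbb{F})$, where $A$ is a nilpotent matrix of nilpotency index $n$, and let $\omega\in\mathbb{F}\setminus\{-1,0,1\}$. Then: (1) If $\omega$ is a primitive $q$-th root of unity, then (a) If $1\le n\le q+1$, then: (i) $\mathcal{C}_\omega(A)=\mathcal{C}_\omega(B)$ if and only if there exists a nonzero $c\in\mathbb{F}$ such that $B=cA$; (ii) there does not exist any $B\in M_k(\mathbb{F})$ such that $\mathcal{C}_\omega(A)=\mathcal{C}_{\omega^{-1}}(B)$. (b) If $n\ge q+2$, then: (i) $\mathcal{C}_\omega(A)=\mathcal{C}_\omega(B)$ holds if and only if $A$ and $B$ are $q$-polynomial equivalent over $\mathbb{F}$; (ii) $\mathcal{C}_\omega(A)=\mathcal{C}_{\omega^{-1}}(B)$ implies $B\in A^{q-1}\mathbb{F}[A^q]$. (2) If $\omega$ is not a primitive $q$-th root of unity for any positive integer $q$, then: (a) $\mathcal{C}_\omega(A)=\mathcal{C}_\omega(B)$ holds if and only if there exists a nonzero $c\in\mathbb{F}$ such that $B=cA$; (b) there does not exist any $B\in M_k(\mathbb{F})$ such that $\mathcal{C}_\omega(A)=\mathcal{C}_{\omega^{-1}}(B)$.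
   Context: $M_k(\mathbb{F})$ is the set of all $k\times k$ matrices over $\mathbb{F}$. For $A\in M_k(\mathbb{F})$ and $\omega\in\mathbb{F}$, the $\omega$-centralizer is $\mathcal{C}_\omega(A)=\{X\in M_k(\mathbb{F})\mid AX=\omega XA\}$. The nilpotency index of a nilpotent matrix $A$ is the least positive integer $n$ with $A^n=O$, where $O$ is the zero matrix. $\mathbb{F}[M]$ denotes the set of all polynomials in the matrix $M$ with coefficients in $\mathbb{F}$ (including constant terms times the identity), and $A^{q-1}\mathbb{F}[A^q]=\{A^{q-1}p(A^q)\mid p(x)\in\mathbb{F}[x]\}$. For a positive integer $q$, matrices $A,B\in M_k(\mathbb{F})$ are $q$-polynomial equivalent over $\mathbb{F}$ if there exist polynomials $j(x)=\sum_{i\ge0}a_{qi+1}x^{qi+1}$ and $h(x)=\sum_{i\ge0}b_{qi+1}x^{qi+1}$ in $\mathbb{F}[x]$ such that $A=h(B)$ and $B=j(A)$.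
   Formalization: In (1)(a)(ii) and (2)(b) the non-existence of B is stated only for A ≠ O; as printed both clauses fail for A = O (index n = 1), since B = O gives C_ω(O) = M_k(F) = C_{ω^{-1}}(O). *)

theory Defs
  imports
    "HOL-Computational_Algebra.Polynomial"
    "Jordan_Normal_Form.Matrix"
begin

definition primitive_root_of_unity :: "nat \<Rightarrow> 'a::field \<Rightarrow> bool" where
  "primitive_root_of_unity q \<omega> \<longleftrightarrow> 0 < q \<and> \<omega> ^ q = 1 \<and> (\<forall>i. 0 < i \<and> i < q \<longrightarrow> \<omega> ^ i \<noteq> 1)"

(* All definitions below are meant for square matrices; their size k is dim_row. *)

definition omega_centralizer :: "'a::field \<Rightarrow> 'a mat \<Rightarrow> 'a mat set" where
  "omega_centralizer \<omega> A =
     {X \<in> carrier_mat (dim_row A) (dim_row A). A * X = \<omega> \<cdot>\<^sub>m (X * A)}"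

definition nilpotent_mat :: "'a::field mat \<Rightarrow> bool" where
  "nilpotent_mat A \<longleftrightarrow> (\<exists>n>0. A ^\<^sub>m n = 0\<^sub>m (dim_row A) (dim_row A))"

definition nilpotency_index :: "'a::field mat \<Rightarrow> nat" where
  "nilpotency_index A = (LEAST n. 0 < n \<and> A ^\<^sub>m n = 0\<^sub>m (dim_row A) (dim_row A))"

(* The matrix p(M) = sum of (coeff p i) M^i. The sum is taken entrywise because matrices of
   unspecified dimension do not form a commutative monoid type class; the term i = 0 contributes
   (coeff p 0) times the identity matrix. *)
definition poly_mat :: "'a::field poly \<Rightarrow> 'a mat \<Rightarrow> 'a mat" where
  "poly_mat p M = mat (dim_row M) (dim_row M)
     (\<lambda>(r, s). \<Sum>i\<le>degree p. coeff p i * (M ^\<^sub>m i) $$ (r, s))"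

definition mat_polynomials :: "'a::field mat \<Rightarrow> 'a mat set" where
  "mat_polynomials M = {poly_mat p M | p. True}"

(* The exponents that occur are of the form q m + 1 with m \<ge> 0; for q = 1 this is
   stronger than being congruent to 1 modulo q, since it excludes the constant term. *)
definition q_exponents :: "nat \<Rightarrow> 'a::field poly \<Rightarrow> bool" where
  "q_exponents q p \<longleftrightarrow> (\<forall>i. coeff p i \<noteq> 0 \<longrightarrow> (\<exists>m. i = q * m + 1))"

definition q_polynomial_equivalent :: "nat \<Rightarrow> 'a::field mat \<Rightarrow> 'a mat \<Rightarrow> bool" where
  "q_polynomial_equivalent q A B \<longleftrightarrow>
     (\<exists>j h. q_exponents q j \<and> q_exponents q h \<and> A = poly_mat h B \<and> B = poly_mat j A)"

end

theory Submission
  imports Defs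
begin

text \<open>
  Everything follows from one description of inclusions between twisted centralizers. Let \<open>A\<close> be
  nilpotent of index \<open>n\<close> and \<open>\<omega> \<noteq> 0\<close>. Then the \<open>\<omega>\<close>-centralizer of \<open>A\<close> is contained in the
  \<open>\<eta>\<close>-centralizer of \<open>B\<close> exactly when \<open>B = p(A)\<close> for a polynomial \<open>p\<close> all of whose exponents \<open>l\<close>
  satisfy \<open>\<omega>^l = \<eta>\<close> (\<open>omega_centralizer_subset_poly_mat\<close> and \<open>centralizer_subsetE\<close>).

  One direction is clear, because \<open>A X = \<omega> X A\<close> gives \<open>A^l X = \<omega>^l X A^l\<close>. The other one rests on explicit
  elements of the centralizer: for every matrix \<open>M\<close> the sum of \<open>\<omega>^(-i) A^i M A^(n-1-i)\<close> over \<open>i < n\<close> lies in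
  the \<open>\<omega>\<close>-centralizer of \<open>A\<close>, since multiplication by \<open>A\<close> on either side shifts the sum and \<open>A^n = 0\<close>
  kills the overflowing term. Testing \<open>B T = \<eta> T B\<close> on these elements \<open>T\<close>, with \<open>M\<close> a matrix unit, and
  fixing the entry taken in the right-hand factor gives \<open>B u(A) = \<eta> g(A)\<close> with polynomials \<open>u\<close> and
  \<open>g\<close>. The constant term of \<open>u\<close> is an entry of \<open>A^(n-1)\<close>, which can be chosen nonzero, so \<open>u(A)\<close> is
  invertible among the polynomials in \<open>A\<close> and \<open>B\<close> is a polynomial \<open>p(A)\<close>. Then
  \<open>T (p(\<omega> A) - \<eta> p(A)) = 0\<close> for all these \<open>T\<close>; the same device, applied to the left-hand factor, gives
  \<open>p(\<omega> A) = \<eta> p(A)\<close>, and comparing coefficients below \<open>n\<close> restricts the exponents of \<open>p\<close>.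

  For \<open>\<eta> = \<omega>\<close> the exponents are those congruent to 1 modulo \<open>q\<close>, or only 1 when \<open>\<omega>\<close> is not a root of
  unity. If 1 is the only such exponent below \<open>n\<close>, then \<open>B\<close> is a multiple of \<open>A\<close>. In general \<open>B\<close> is
  nilpotent because \<open>p\<close> has no constant term, and exchanging \<open>A\<close> and \<open>B\<close> gives \<open>q\<close>-polynomial equivalence. For \<open>\<eta> = 1/\<omega>\<close> the
  exponents are congruent to -1 modulo \<open>q\<close>. They are at least 2 because \<open>\<omega> \<noteq> 1\<close> and
  \<open>\<omega>^2 \<noteq> 1\<close>, so equality of the two centralizers would express \<open>A\<close> as a polynomial in \<open>B\<close>, hence in
  \<open>A\<close>, without constant or linear term; that forces \<open>A = 0\<close> (\<open>centralizer_neq_inverse_centralizer\<close>).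
\<close>

section \<open>Square matrices and their powers\<close>

lemma square_mult_index:
  fixes M N :: "'a::field mat"
  assumes "M \<in> carrier_mat k k" "N \<in> carrier_mat k k" "r < k" "s < k"
  shows "(M * N) $$ (r, s) = (\<Sum>t<k. M $$ (r, t) * N $$ (t, s))"
  using assms by (simp add: scalar_prod_def atLeast0LessThan)

lemma pow_mat_add:
  fixes M :: "'a::field mat"
  assumes M: "M \<in> carrier_mat k k"
  shows "M ^\<^sub>m (i + j) = M ^\<^sub>m i * M ^\<^sub>m j"
proof (induction j)
  case 0
  then show ?case using M by simp
next
  case (Suc j)
  then show ?case
    using assoc_mult_mat[OF pow_carrier_mat[OF M, of i] pow_carrier_mat[OF M, of j] M] by simp
qed

lemma pow_mat_Suc_left:
  fixes M :: "'a::field mat"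
  assumes M: "M \<in> carrier_mat k k"
  shows "M ^\<^sub>m Suc i = M * M ^\<^sub>m i"
  using pow_mat_add[OF M, of 1 i] M by simp

section \<open>Evaluating polynomials at a matrix\<close>

lemma poly_mat_carrier [simp]:
  "M \<in> carrier_mat k k \<Longrightarrow> poly_mat p M \<in> carrier_mat k k"
  by (auto simp: poly_mat_def)

lemma poly_mat_index:
  assumes "M \<in> carrier_mat k k" "r < k" "s < k" "degree p \<le> N"
  shows "poly_mat p M $$ (r, s) = (\<Sum>i\<le>N. coeff p i * (M ^\<^sub>m i) $$ (r, s))"
proof -
  have "(\<Sum>i\<le>degree p. coeff p i * (M ^\<^sub>m i) $$ (r, s)) =
        (\<Sum>i\<le>N. coeff p i * (M ^\<^sub>m i) $$ (r, s))"
    using assms(4) by (intro sum.mono_neutral_left) (auto simp: coeff_eq_0)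
  then show ?thesis using assms by (simp add: poly_mat_def)
qed

lemma poly_mat_0 [simp]:
  assumes "M \<in> carrier_mat k k"
  shows "poly_mat 0 M = 0\<^sub>m k k"
  using assms by (auto simp: poly_mat_def)

lemma poly_mat_add:
  assumes M: "M \<in> carrier_mat k k"
  shows "poly_mat (p + q) M = poly_mat p M + poly_mat q M"
proof (rule eq_matI)
  fix r s assume "r < dim_row (poly_mat p M + poly_mat q M)"
    and "s < dim_col (poly_mat p M + poly_mat q M)"
  then have rs: "r < k" "s < k" using M by (auto simp: poly_mat_def)
  let ?N = "max (degree p) (degree q)"
  have "degree (p + q) \<le> ?N" by (rule degree_add_le_max)
  then show "poly_mat (p + q) M $$ (r, s) = (poly_mat p M + poly_mat q M) $$ (r, s)"
    using M rs poly_mat_carrier[OF M, of p] poly_mat_carrier[OF M, of q]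
    by (simp add: poly_mat_index[OF M rs, of _ ?N] algebra_simps sum.distrib
        carrier_matD[OF poly_mat_carrier[OF M]])
qed (use M in \<open>auto simp: poly_mat_def\<close>)

lemma poly_mat_smult:
  assumes M: "M \<in> carrier_mat k k"
  shows "poly_mat (Polynomial.smult c p) M = c \<cdot>\<^sub>m poly_mat p M"
proof (rule eq_matI)
  fix r s assume "r < dim_row (c \<cdot>\<^sub>m poly_mat p M)" and "s < dim_col (c \<cdot>\<^sub>m poly_mat p M)"
  then have rs: "r < k" "s < k" using M by (auto simp: poly_mat_def)
  then show "poly_mat (Polynomial.smult c p) M $$ (r, s) = (c \<cdot>\<^sub>m poly_mat p M) $$ (r, s)"
    using M by (simp add: poly_mat_index[OF M rs, of _ "degree p"] algebra_simps sum_distrib_left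
        carrier_matD[OF poly_mat_carrier[OF M]])
qed (use M in \<open>auto simp: poly_mat_def\<close>)

lemma poly_mat_monom:
  assumes M: "M \<in> carrier_mat k k"
  shows "poly_mat (monom c i) M = c \<cdot>\<^sub>m M ^\<^sub>m i"
proof (rule eq_matI)
  fix r s assume "r < dim_row (c \<cdot>\<^sub>m M ^\<^sub>m i)" and "s < dim_col (c \<cdot>\<^sub>m M ^\<^sub>m i)"
  then have rs: "r < k" "s < k" using M carrier_matD[OF pow_carrier_mat[OF M, of i]] by auto
  have "poly_mat (monom c i) M $$ (r, s) =
      (\<Sum>j\<le>i. (if i = j then c else 0) * (M ^\<^sub>m j) $$ (r, s))"
    by (simp add: poly_mat_index[OF M rs degree_monom_le])
  also have "\<dots> = (\<Sum>j\<le>i. if i = j then c * (M ^\<^sub>m j) $$ (r, s) else 0)"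
    by (intro sum.cong) auto
  finally show "poly_mat (monom c i) M $$ (r, s) = (c \<cdot>\<^sub>m M ^\<^sub>m i) $$ (r, s)"
    using M rs by simp
qed (use M in \<open>auto simp: poly_mat_def\<close>)

lemma poly_mat_monom_1:
  assumes M: "M \<in> carrier_mat k k"
  shows "poly_mat (monom 1 i) M = M ^\<^sub>m i"
  unfolding poly_mat_monom[OF M] by (intro eq_matI) auto

lemma poly_mat_const:
  assumes M: "M \<in> carrier_mat k k"
  shows "poly_mat [:a:] M = a \<cdot>\<^sub>m 1\<^sub>m k"
  using poly_mat_monom[OF M, of a 0] M by (simp add: monom_0)

lemma poly_mat_1 [simp]:
  assumes M: "M \<in> carrier_mat k k"
  shows "poly_mat 1 M = 1\<^sub>m k"
  unfolding one_pCons poly_mat_const[OF M] by (intro eq_matI) auto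

lemma poly_mat_pCons:
  assumes M: "M \<in> carrier_mat k k"
  shows "poly_mat (pCons a p) M = a \<cdot>\<^sub>m 1\<^sub>m k + M * poly_mat p M"
proof (rule eq_matI)
  fix r s assume "r < dim_row (a \<cdot>\<^sub>m 1\<^sub>m k + M * poly_mat p M)"
    and "s < dim_col (a \<cdot>\<^sub>m 1\<^sub>m k + M * poly_mat p M)"
  then have rs: "r < k" "s < k" using M by (auto simp: poly_mat_def)
  have "(M * poly_mat p M) $$ (r, s) =
      (\<Sum>t<k. M $$ (r, t) * (\<Sum>i\<le>degree p. coeff p i * (M ^\<^sub>m i) $$ (t, s)))"
    unfolding square_mult_index[OF M poly_mat_carrier[OF M] rs]
    using rs by (intro sum.cong refl) (simp add: poly_mat_index[OF M _ _ order_refl])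
  also have "\<dots> = (\<Sum>i\<le>degree p. coeff p i * (\<Sum>t<k. M $$ (r, t) * (M ^\<^sub>m i) $$ (t, s)))"
    by (simp add: sum_distrib_left sum.swap[of _ "{..<k}"] algebra_simps)
  also have "\<dots> = (\<Sum>i\<le>degree p. coeff p i * (M ^\<^sub>m Suc i) $$ (r, s))"
    unfolding pow_mat_Suc_left[OF M] square_mult_index[OF M pow_carrier_mat[OF M] rs] ..
  finally have "(M * poly_mat p M) $$ (r, s) =
      (\<Sum>i\<le>degree p. coeff p i * (M ^\<^sub>m Suc i) $$ (r, s))" .
  moreover have "poly_mat (pCons a p) M $$ (r, s) =
      a * (M ^\<^sub>m 0) $$ (r, s) + (\<Sum>i\<le>degree p. coeff p i * (M ^\<^sub>m Suc i) $$ (r, s))"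
    unfolding poly_mat_index[OF M rs degree_pCons_le] sum.atMost_Suc_shift by simp
  moreover have "(a \<cdot>\<^sub>m 1\<^sub>m k + M * poly_mat p M) $$ (r, s) =
      a * (M ^\<^sub>m 0) $$ (r, s) + (M * poly_mat p M) $$ (r, s)"
    using M rs carrier_matD[OF poly_mat_carrier[OF M, of p]]
    by (simp del: index_mult_mat(1))
  ultimately show "poly_mat (pCons a p) M $$ (r, s) =
      (a \<cdot>\<^sub>m 1\<^sub>m k + M * poly_mat p M) $$ (r, s)" by simp
qed (use M in \<open>auto simp: poly_mat_def\<close>)

lemma poly_mat_mult:
  assumes M: "M \<in> carrier_mat k k"
  shows "poly_mat (p * q) M = poly_mat p M * poly_mat q M"
proof (induction p)
  case 0
  then show ?case using M by (simp add: left_mult_zero_mat[OF poly_mat_carrier[OF M]])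
next
  case (pCons a p)
  note C = poly_mat_carrier[OF M]
  have "poly_mat (pCons a p * q) M = a \<cdot>\<^sub>m poly_mat q M + poly_mat (pCons 0 (p * q)) M"
    by (simp add: poly_mat_add[OF M] poly_mat_smult[OF M])
  also have "poly_mat (pCons 0 (p * q)) M = M * (poly_mat p M * poly_mat q M)"
  proof -
    have "(0::'a) \<cdot>\<^sub>m 1\<^sub>m k = 0\<^sub>m k k" by (intro eq_matI) auto
    then show ?thesis
      using left_add_zero_mat[OF mult_carrier_mat[OF M mult_carrier_mat[OF C C]]]
      by (simp add: poly_mat_pCons[OF M] pCons.IH)
  qed
  also have "a \<cdot>\<^sub>m poly_mat q M + M * (poly_mat p M * poly_mat q M) =
      (a \<cdot>\<^sub>m 1\<^sub>m k) * poly_mat q M + (M * poly_mat p M) * poly_mat q M"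
    using mult_smult_assoc_mat[OF one_carrier_mat C, of a q] assoc_mult_mat[OF M C C, of p q]
      left_mult_one_mat[OF C, of q]
    by simp
  also have "\<dots> = poly_mat (pCons a p) M * poly_mat q M"
    unfolding poly_mat_pCons[OF M]
    by (rule add_mult_distrib_mat[OF _ mult_carrier_mat[OF M C] C, symmetric]) simp
  finally show ?case .
qed

lemma poly_mat_pcompose:
  assumes M: "M \<in> carrier_mat k k"
  shows "poly_mat (pcompose p q) M = poly_mat p (poly_mat q M)"
proof (induction p)
  case 0
  then show ?case by (simp add: poly_mat_0[OF M] poly_mat_0[OF poly_mat_carrier[OF M]])
next
  case (pCons a p)
  then show ?case
    by (simp add: pcompose_pCons poly_mat_const[OF M] poly_mat_add[OF M] poly_mat_mult[OF M] pCons.IH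
        poly_mat_pCons[OF poly_mat_carrier[OF M]])
qed

lemma poly_mat_linear:
  assumes M: "M \<in> carrier_mat k k"
  shows "poly_mat [:0, c:] M = c \<cdot>\<^sub>m M"
  using poly_mat_monom[OF M, of c 1] M by (simp add: monom_Suc monom_0)

lemma coeff_sum_monom_lessThan:
  "coeff (\<Sum>i<n. monom (c i) i) j = (if j < n then c j else 0)"
  by (simp add: coeff_sum)

lemma poly_mat_sum_monom_index:
  assumes M: "M \<in> carrier_mat k k" and rs: "r < k" "s < k"
  shows "poly_mat (\<Sum>i<n. monom (c i) i) M $$ (r, s) = (\<Sum>i<n. c i * (M ^\<^sub>m i) $$ (r, s))"
proof -
  have "degree (\<Sum>i<n. monom (c i) i) \<le> n"
    by (rule degree_le) (simp add: coeff_sum_monom_lessThan)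
  then have "poly_mat (\<Sum>i<n. monom (c i) i) M $$ (r, s) =
      (\<Sum>i\<le>n. (if i < n then c i else 0) * (M ^\<^sub>m i) $$ (r, s))"
    by (simp add: poly_mat_index[OF M rs] coeff_sum_monom_lessThan)
  also have "\<dots> = (\<Sum>i<n. c i * (M ^\<^sub>m i) $$ (r, s))"
    by (intro sum.mono_neutral_cong_right) auto
  finally show ?thesis .
qed

section \<open>Polynomials in a matrix act on its twisted centralizer\<close>

lemma omega_centralizerD:
  assumes "X \<in> omega_centralizer \<omega> M" and "M \<in> carrier_mat k k"
  shows "X \<in> carrier_mat k k" and "M * X = \<omega> \<cdot>\<^sub>m (X * M)"
  using assms by (auto simp: omega_centralizer_def)

text \<open>Moving \<open>X\<close> to the left past \<open>M\<close> replaces \<open>M\<close> by \<open>\<omega> M\<close>, hence \<open>p(M)\<close> by \<open>p(\<omega> M)\<close>; the latter is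
  the composition of \<open>p\<close> with \<open>\<omega> x\<close>, evaluated at \<open>M\<close>.\<close>

lemma poly_mat_twisted_commute:
  assumes M: "M \<in> carrier_mat k k" and X: "X \<in> omega_centralizer \<omega> M"
  shows "poly_mat p M * X = X * poly_mat (pcompose p [:0, \<omega>:]) M"
proof (induction p)
  case 0
  then show ?case using M omega_centralizerD[OF X M] by simp
next
  case (pCons a p)
  let ?P = "poly_mat p M" and ?Q = "poly_mat (pcompose p [:0, \<omega>:]) M"
  have Xc: "X \<in> carrier_mat k k" and MX: "M * X = \<omega> \<cdot>\<^sub>m (X * M)"
    using omega_centralizerD[OF X M] by auto
  note C = poly_mat_carrier[OF M]
  have one: "a \<cdot>\<^sub>m 1\<^sub>m k \<in> carrier_mat k k" by simp
  have "poly_mat (pCons a p) M * X = (a \<cdot>\<^sub>m 1\<^sub>m k) * X + (M * ?P) * X"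
    unfolding poly_mat_pCons[OF M]
    by (rule add_mult_distrib_mat[OF one mult_carrier_mat[OF M C] Xc])
  also have "(a \<cdot>\<^sub>m 1\<^sub>m k) * X = X * (a \<cdot>\<^sub>m 1\<^sub>m k)"
    using Xc by (simp add: mult_smult_assoc_mat[OF one_carrier_mat Xc]
        mult_smult_distrib[OF Xc one_carrier_mat])
  also have "(M * ?P) * X = M * (X * ?Q)"
    using assoc_mult_mat[OF M C Xc] pCons.IH by simp
  also have "\<dots> = \<omega> \<cdot>\<^sub>m (X * M) * ?Q"
    using assoc_mult_mat[OF M Xc C] MX by simp
  also have "\<dots> = X * ((\<omega> \<cdot>\<^sub>m M) * ?Q)"
    using mult_smult_assoc_mat[OF mult_carrier_mat[OF Xc M] C, of \<omega>]
      mult_smult_assoc_mat[OF M C, of \<omega>] mult_smult_distrib[OF Xc mult_carrier_mat[OF M C], of \<omega>]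
      assoc_mult_mat[OF Xc M C]
    by simp
  also have "X * (a \<cdot>\<^sub>m 1\<^sub>m k) + \<dots> = X * (a \<cdot>\<^sub>m 1\<^sub>m k + (\<omega> \<cdot>\<^sub>m M) * ?Q)"
    by (rule mult_add_distrib_mat[OF Xc one, symmetric])
      (use mult_carrier_mat[OF smult_carrier_mat[OF M] C] in auto)
  also have "a \<cdot>\<^sub>m 1\<^sub>m k + (\<omega> \<cdot>\<^sub>m M) * ?Q = poly_mat (pcompose (pCons a p) [:0, \<omega>:]) M"
    unfolding pcompose_pCons poly_mat_add[OF M] poly_mat_mult[OF M] poly_mat_linear[OF M]
      poly_mat_const[OF M] ..
  finally show ?case .
qed

lemma pcompose_scale_eq_smult:
  fixes p :: "'a::field poly"
  assumes "\<And>l. coeff p l \<noteq> 0 \<Longrightarrow> \<omega> ^ l = \<eta>"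
  shows "pcompose p [:0, \<omega>:] = Polynomial.smult \<eta> p"
  using assms by (auto simp: poly_eq_iff coeff_pcompose_linear)

text \<open>The exponent condition says that \<open>p(\<omega> x) = \<eta> p(x)\<close>, so that every \<open>X\<close> passes \<open>p(M)\<close> with the
  factor \<open>\<eta>\<close>.\<close>

lemma omega_centralizer_subset_poly_mat:
  assumes M: "M \<in> carrier_mat k k" and p: "\<And>l. coeff p l \<noteq> 0 \<Longrightarrow> \<omega> ^ l = \<eta>"
  shows "omega_centralizer \<omega> M \<subseteq> omega_centralizer \<eta> (poly_mat p M)"
proof
  fix X assume X: "X \<in> omega_centralizer \<omega> M"
  note Xc = omega_centralizerD(1)[OF X M]
  have "poly_mat p M * X = X * (\<eta> \<cdot>\<^sub>m poly_mat p M)"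
    using poly_mat_twisted_commute[OF M X, of p]
    by (simp add: pcompose_scale_eq_smult[OF p] poly_mat_smult[OF M])
  then show "X \<in> omega_centralizer \<eta> (poly_mat p M)"
    using Xc M mult_smult_distrib[OF Xc poly_mat_carrier[OF M]]
      carrier_matD[OF poly_mat_carrier[OF M, of p]]
    by (simp add: omega_centralizer_def)
qed

section \<open>Polynomials in a nilpotent matrix\<close>

text \<open>The coefficients of the inverse are found one at a time, as for formal power series.\<close>

lemma poly_inverse_mod_power:
  fixes u :: "'a::field poly"
  assumes "coeff u 0 \<noteq> 0"
  shows "\<exists>v w. u * v = 1 + monom 1 n * w"
proof (induction n)
  case 0
  show ?case by (rule exI[of _ 0], rule exI[of _ "-1"]) simp
next
  case (Suc n)
  then obtain v w where vw: "u * v = 1 + monom 1 n * w" by blast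
  \<comment> \<open>This choice cancels the coefficient of degree \<open>n\<close> in the error term.\<close>
  define c where "c = - coeff w 0 / coeff u 0"
  have "coeff (w + Polynomial.smult c u) 0 = 0" using assms by (simp add: c_def)
  then obtain w' where w': "w + Polynomial.smult c u = pCons 0 w'"
    by (metis pCons_cases coeff_pCons_0)
  have "u * (v + monom c n) = 1 + monom 1 n * (w + Polynomial.smult c u)"
    
    by (simp add: distrib_left vw add.assoc)
      (simp add: monom_altdef mult.commute)
  also have "\<dots> = 1 + monom 1 (Suc n) * w'" by (simp add: w' monom_Suc)
  finally show ?case by blast
qed

locale nilpotent_matrix =
  fixes A :: "'a::field mat" and k n :: nat
  assumes A: "A \<in> carrier_mat k k"
    and pow_n: "A ^\<^sub>m n = 0\<^sub>m k k"
    and pow_before_n: "A ^\<^sub>m (n - 1) \<noteq> 0\<^sub>m k k"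
    and n_pos: "0 < n"
begin

lemma pow_zero: "n \<le> i \<Longrightarrow> A ^\<^sub>m i = 0\<^sub>m k k"
  using pow_mat_add[OF A, of n "i - n"] pow_n A
  by (simp add: left_mult_zero_mat[OF pow_carrier_mat])

lemma pow_zero_iff: "A ^\<^sub>m i = 0\<^sub>m k k \<longleftrightarrow> n \<le> i"
proof
  assume i: "A ^\<^sub>m i = 0\<^sub>m k k"
  show "n \<le> i"
  proof (rule ccontr)
    assume "\<not> n \<le> i"
    then have "n - 1 = i + (n - 1 - i)" by simp
    then have "A ^\<^sub>m (n - 1) = A ^\<^sub>m i * A ^\<^sub>m (n - 1 - i)"
      by (metis pow_mat_add[OF A])
    then show False
      using i pow_before_n by (simp add: left_mult_zero_mat[OF pow_carrier_mat[OF A]])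
  qed
qed (rule pow_zero)

lemma pow_entry_nonzero:
  obtains r s where "r < k" "s < k" "(A ^\<^sub>m (n - 1)) $$ (r, s) \<noteq> 0"
proof -
  have "\<exists>r s. r < k \<and> s < k \<and> (A ^\<^sub>m (n - 1)) $$ (r, s) \<noteq> 0"
  proof (rule ccontr)
    assume "\<nexists>r s. r < k \<and> s < k \<and> (A ^\<^sub>m (n - 1)) $$ (r, s) \<noteq> 0"
    then have "A ^\<^sub>m (n - 1) = 0\<^sub>m k k" using A by (intro eq_matI) auto
    then show False using pow_before_n by simp
  qed
  then show thesis using that by blast
qed

lemma poly_mat_right_inverse:
  assumes "coeff u 0 \<noteq> 0"
  obtains v where "poly_mat u A * poly_mat v A = 1\<^sub>m k"
proof -
  obtain v w where vw: "u * v = 1 + monom 1 n * w" using poly_inverse_mod_power[OF assms] by blast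
  have z: "poly_mat (monom 1 n) A = 0\<^sub>m k k" by (simp add: poly_mat_monom_1[OF A] pow_n)
  have "poly_mat u A * poly_mat v A = poly_mat (1 + monom 1 n * w) A"
    by (simp flip: vw add: poly_mat_mult[OF A])
  also have "\<dots> = 1\<^sub>m k"
    using A by (simp add: poly_mat_add[OF A] poly_mat_mult[OF A] z
        left_mult_zero_mat[OF poly_mat_carrier])
  finally show thesis by (rule that)
qed

lemma poly_mat_unit_cancel:
  assumes "coeff u 0 \<noteq> 0" and "poly_mat (u * d) A = 0\<^sub>m k k"
  shows "poly_mat d A = 0\<^sub>m k k"
proof -
  obtain v where v: "poly_mat u A * poly_mat v A = 1\<^sub>m k"
    by (rule poly_mat_right_inverse[OF assms(1)])
  have "poly_mat d A = poly_mat (u * v) A * poly_mat d A"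
    by (simp add: poly_mat_mult[OF A] v left_mult_one_mat[OF poly_mat_carrier[OF A]])
  also have "\<dots> = poly_mat ((u * d) * v) A"
    by (simp add: mult_ac flip: poly_mat_mult[OF A])
  also have "\<dots> = 0\<^sub>m k k"
    by (subst poly_mat_mult[OF A])
      (simp add: assms(2) left_mult_zero_mat[OF poly_mat_carrier[OF A]])
  finally show ?thesis .
qed

text \<open>The powers of \<open>A\<close> below the nilpotency index are linearly independent: up to an invertible factor, a
  polynomial in \<open>A\<close> is the power of \<open>A\<close> given by its lowest exponent.\<close>

lemma annihilating_coeff_zero:
  assumes d: "poly_mat d A = 0\<^sub>m k k" and "l < n"
  shows "coeff d l = 0"
  using \<open>l < n\<close>
proof (induction l rule: less_induct)
  case (less l)
  have "\<forall>j<l. coeff d j = 0" using less by simp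
  then have "monom 1 l dvd d" by (simp add: monom_1_dvd_iff')
  then obtain u where u: "d = u * monom 1 l" by (auto simp: dvd_def mult.commute)
  show ?case
  proof (rule ccontr)
    assume "coeff d l \<noteq> 0"
    then have "coeff u 0 \<noteq> 0" by (simp add: u coeff_monom_mult mult.commute[of u])
    from poly_mat_unit_cancel[OF this] d have "poly_mat (monom 1 l) A = 0\<^sub>m k k"
      by (simp add: u)
    then show False using less.prems by (simp add: poly_mat_monom_1[OF A] pow_zero_iff)
  qed
qed

lemma poly_mat_cutoff: "poly_mat (poly_cutoff n p) A = poly_mat p A"
proof (rule eq_matI)
  fix r s assume "r < dim_row (poly_mat p A)" and "s < dim_col (poly_mat p A)"
  then have rs: "r < k" "s < k" using A by (auto simp: poly_mat_def)
  have "degree (poly_cutoff n p) \<le> degree p"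
    by (rule degree_le) (simp add: coeff_poly_cutoff coeff_eq_0)
  then show "poly_mat (poly_cutoff n p) A $$ (r, s) = poly_mat p A $$ (r, s)"
    using rs pow_zero
    by (auto simp: poly_mat_index[OF A rs, of _ "degree p"] coeff_poly_cutoff intro!: sum.cong)
qed (use A in \<open>auto simp: poly_mat_def\<close>)

section \<open>Explicit elements of the twisted centralizer\<close>

text \<open>The sum of \<open>\<omega>^(-i) A^i E A^(n-1-i)\<close> over \<open>i < n\<close>, where \<open>E\<close> is the matrix unit with its 1 in row \<open>a\<close> and
  column \<open>b\<close>. Matrix units suffice for testing, and for them the entries become products of an entry from
  the left-hand factor with one from the right-hand factor, which can be varied independently.\<close>

definition intertwiner :: "'a \<Rightarrow> nat \<Rightarrow> nat \<Rightarrow> 'a mat" where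
  "intertwiner \<omega> a b = mat k k (\<lambda>(r, s).
     \<Sum>i<n. inverse \<omega> ^ i * (A ^\<^sub>m i) $$ (r, a) * (A ^\<^sub>m (n - 1 - i)) $$ (b, s))"

lemma intertwiner_carrier [simp]: "intertwiner \<omega> a b \<in> carrier_mat k k"
  by (simp add: intertwiner_def)

lemma mult_intertwiner_index:
  assumes N: "N \<in> carrier_mat k k" and "r < k" "s < k" "a < k"
  shows "(N * intertwiner \<omega> a b) $$ (r, s) =
    (\<Sum>i<n. inverse \<omega> ^ i * (N * A ^\<^sub>m i) $$ (r, a) * (A ^\<^sub>m (n - 1 - i)) $$ (b, s))"
proof -
  have "(N * intertwiner \<omega> a b) $$ (r, s) = (\<Sum>t<k. \<Sum>i<n.
      inverse \<omega> ^ i * (N $$ (r, t) * (A ^\<^sub>m i) $$ (t, a)) * (A ^\<^sub>m (n - 1 - i)) $$ (b, s))"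
    unfolding square_mult_index[OF N intertwiner_carrier assms(2,3)]
    using assms by (simp add: intertwiner_def sum_distrib_left mult_ac)
  also have "\<dots> = (\<Sum>i<n. inverse \<omega> ^ i * (\<Sum>t<k. N $$ (r, t) * (A ^\<^sub>m i) $$ (t, a)) *
      (A ^\<^sub>m (n - 1 - i)) $$ (b, s))"
    by (subst sum.swap) (simp add: sum_distrib_left sum_distrib_right)
  finally show ?thesis
    using assms by (simp add: square_mult_index[OF N pow_carrier_mat[OF A]])
qed

lemma intertwiner_mult_index:
  assumes N: "N \<in> carrier_mat k k" and "r < k" "s < k" "b < k"
  shows "(intertwiner \<omega> a b * N) $$ (r, s) =
    (\<Sum>i<n. inverse \<omega> ^ i * (A ^\<^sub>m i) $$ (r, a) * (A ^\<^sub>m (n - 1 - i) * N) $$ (b, s))"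
proof -
  have "(intertwiner \<omega> a b * N) $$ (r, s) = (\<Sum>t<k. \<Sum>i<n.
      inverse \<omega> ^ i * (A ^\<^sub>m i) $$ (r, a) * ((A ^\<^sub>m (n - 1 - i)) $$ (b, t) * N $$ (t, s)))"
    unfolding square_mult_index[OF intertwiner_carrier N assms(2,3)]
    using assms by (simp add: intertwiner_def sum_distrib_right mult.assoc)
  also have "\<dots> = (\<Sum>i<n. inverse \<omega> ^ i * (A ^\<^sub>m i) $$ (r, a) *
      (\<Sum>t<k. (A ^\<^sub>m (n - 1 - i)) $$ (b, t) * N $$ (t, s)))"
    by (subst sum.swap) (simp add: sum_distrib_left)
  finally show ?thesis
    using assms by (simp add: square_mult_index[OF pow_carrier_mat[OF A] N])
qed

text \<open>Both \<open>A T\<close> and \<open>\<omega> T A\<close> are sums of the terms \<open>\<omega>^(1-i) A^i E A^(n-i)\<close>, over \<open>1 \<le> i \<le> n\<close> and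
  \<open>0 \<le> i < n\<close> respectively. They agree because the terms for \<open>i = 0\<close> and \<open>i = n\<close> contain \<open>A^n = 0\<close>.\<close>

lemma intertwiner_in_centralizer:
  assumes "\<omega> \<noteq> 0" and ab: "a < k" "b < k"
  shows "intertwiner \<omega> a b \<in> omega_centralizer \<omega> A"
proof -
  let ?T = "intertwiner \<omega> a b"
  have "A * ?T = \<omega> \<cdot>\<^sub>m (?T * A)"
  proof (rule eq_matI)
    fix r s assume "r < dim_row (\<omega> \<cdot>\<^sub>m (?T * A))" and "s < dim_col (\<omega> \<cdot>\<^sub>m (?T * A))"
    then have rs: "r < k" "s < k" using A by (auto simp: intertwiner_def)
    define F where
      "F i = \<omega> * inverse \<omega> ^ i * (A ^\<^sub>m i) $$ (r, a) * (A ^\<^sub>m (n - i)) $$ (b, s)" for i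
    have ends: "F 0 = 0" "F n = 0" using rs ab pow_n by (simp_all add: F_def)
    have "(A * ?T) $$ (r, s) = (\<Sum>i<n. F (Suc i))"
      unfolding mult_intertwiner_index[OF A rs ab(1)] F_def
      using \<open>\<omega> \<noteq> 0\<close> by (intro sum.cong refl) (simp add: pow_mat_Suc_left[OF A] del: pow_mat.simps)
    also have "\<dots> = (\<Sum>i<n. F i)"
      using sum.lessThan_Suc_shift[of F n] ends by simp
    also have "\<dots> = \<omega> * (?T * A) $$ (r, s)"
      unfolding intertwiner_mult_index[OF A rs ab(2)] sum_distrib_left F_def
    proof (intro sum.cong refl)
      fix i assume "i \<in> {..<n}"
      then have "n - i = Suc (n - 1 - i)" by auto
      then have "A ^\<^sub>m (n - i) = A ^\<^sub>m (n - 1 - i) * A" by (metis pow_mat.simps(2))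
      then show "\<omega> * inverse \<omega> ^ i * (A ^\<^sub>m i) $$ (r, a) * (A ^\<^sub>m (n - i)) $$ (b, s) =
          \<omega> * (inverse \<omega> ^ i * (A ^\<^sub>m i) $$ (r, a) * (A ^\<^sub>m (n - 1 - i) * A) $$ (b, s))"
        by (simp only: mult_ac)
    qed
    finally show "(A * ?T) $$ (r, s) = (\<omega> \<cdot>\<^sub>m (?T * A)) $$ (r, s)"
      using rs A by (simp add: carrier_matD[OF intertwiner_carrier])
  qed (use A in \<open>auto simp: intertwiner_def\<close>)
  then show ?thesis using A by (simp add: omega_centralizer_def)
qed

section \<open>Inclusions of twisted centralizers\<close>

text \<open>The relation \<open>B T = \<eta> T B\<close> is bilinear in the left-hand and right-hand factors of \<open>T\<close>. Reading it at one fixed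
  entry \<open>(b, s)\<close> of the right-hand factor turns it into a relation between \<open>B u(A)\<close> and a polynomial in
  \<open>A\<close>. The entry is chosen such that \<open>A^(n-1)\<close> does not vanish there, which makes \<open>u(A)\<close> invertible.\<close>

lemma centralizer_subset_imp_poly_mat:
  assumes B: "B \<in> carrier_mat k k" and "\<omega> \<noteq> 0"
    and sub: "omega_centralizer \<omega> A \<subseteq> omega_centralizer \<eta> B"
  shows "\<exists>p. B = poly_mat p A"
proof -
  obtain b s where bs: "b < k" "s < k" "(A ^\<^sub>m (n - 1)) $$ (b, s) \<noteq> 0"
    by (rule pow_entry_nonzero)
  define u where "u = (\<Sum>i<n. monom (inverse \<omega> ^ i * (A ^\<^sub>m (n - 1 - i)) $$ (b, s)) i)"
  define g where "g = (\<Sum>i<n. monom (inverse \<omega> ^ i * (A ^\<^sub>m (n - 1 - i) * B) $$ (b, s)) i)"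
  note C = poly_mat_carrier[OF A]
  have "B * poly_mat u A = \<eta> \<cdot>\<^sub>m poly_mat g A"
  proof (rule eq_matI)
    fix r a assume "r < dim_row (\<eta> \<cdot>\<^sub>m poly_mat g A)" and "a < dim_col (\<eta> \<cdot>\<^sub>m poly_mat g A)"
    then have ra: "r < k" "a < k" using A by (auto simp: poly_mat_def)
    let ?T = "intertwiner \<omega> a b"
    have "?T \<in> omega_centralizer \<eta> B"
      using intertwiner_in_centralizer[OF \<open>\<omega> \<noteq> 0\<close> ra(2) bs(1)] sub by blast
    from omega_centralizerD(2)[OF this B]
    have BT: "(B * ?T) $$ (r, s) = \<eta> * (?T * B) $$ (r, s)"
      using ra bs B by (simp add: carrier_matD[OF intertwiner_carrier])
    have "(B * poly_mat u A) $$ (r, a) = (\<Sum>t<k. \<Sum>i<n.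
        inverse \<omega> ^ i * (B $$ (r, t) * (A ^\<^sub>m i) $$ (t, a)) * (A ^\<^sub>m (n - 1 - i)) $$ (b, s))"
      using ra by (simp add: square_mult_index[OF B C] u_def poly_mat_sum_monom_index[OF A]
          sum_distrib_left mult_ac)
    also have "\<dots> = (\<Sum>i<n. inverse \<omega> ^ i * (B * A ^\<^sub>m i) $$ (r, a) *
        (A ^\<^sub>m (n - 1 - i)) $$ (b, s))"
      by (subst sum.swap) (simp only: square_mult_index[OF B pow_carrier_mat[OF A] ra]
          sum_distrib_left sum_distrib_right)
    also have "\<dots> = \<eta> * (?T * B) $$ (r, s)"
      using BT mult_intertwiner_index[OF B ra(1) bs(2) ra(2)] by simp
    also have "\<dots> = \<eta> * poly_mat g A $$ (r, a)"
      unfolding intertwiner_mult_index[OF B ra(1) bs(2) bs(1)] g_def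
        poly_mat_sum_monom_index[OF A ra] by (simp only: mult_ac)
    finally show "(B * poly_mat u A) $$ (r, a) = (\<eta> \<cdot>\<^sub>m poly_mat g A) $$ (r, a)"
      using ra by (simp add: carrier_matD[OF C])
  qed (use A B in \<open>auto simp: poly_mat_def\<close>)
  moreover have "coeff u 0 \<noteq> 0"
    using n_pos bs(3) by (simp add: u_def coeff_sum_monom_lessThan)
  then obtain v where v: "poly_mat u A * poly_mat v A = 1\<^sub>m k" by (rule poly_mat_right_inverse)
  ultimately have "B = (\<eta> \<cdot>\<^sub>m poly_mat g A) * poly_mat v A"
    using assoc_mult_mat[OF B C C, of u v] B by simp
  also have "\<dots> = poly_mat (Polynomial.smult \<eta> g * v) A"
    by (simp only: poly_mat_mult[OF A] poly_mat_smult[OF A])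
  finally show ?thesis by blast
qed

text \<open>If \<open>T D = 0\<close> for all intertwiners \<open>T\<close>, where \<open>D = d(A)\<close>, then fixing an entry of the left-hand factor
  where \<open>A^(n-1)\<close> does not vanish yields \<open>u(A) D = 0\<close> with a polynomial \<open>u\<close> that has nonzero constant term.\<close>

lemma intertwiner_faithful:
  assumes "\<omega> \<noteq> 0"
    and zero: "\<And>a b. a < k \<Longrightarrow> b < k \<Longrightarrow> intertwiner \<omega> a b * poly_mat d A = 0\<^sub>m k k"
  shows "poly_mat d A = 0\<^sub>m k k"
proof -
  obtain r a where ra: "r < k" "a < k" "(A ^\<^sub>m (n - 1)) $$ (r, a) \<noteq> 0"
    by (rule pow_entry_nonzero)
  \<comment> \<open>The right-hand factor carries the exponent \<open>n - 1 - i\<close>, so \<open>u\<close> lists the weights in reverse order.\<close>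
  define c where "c j = inverse \<omega> ^ (n - 1 - j) * (A ^\<^sub>m (n - 1 - j)) $$ (r, a)" for j
  define u where "u = (\<Sum>j<n. monom (c j) j)"
  note C = poly_mat_carrier[OF A]
  have "poly_mat u A * poly_mat d A = 0\<^sub>m k k"
  proof (rule eq_matI)
    fix b s assume "b < dim_row (0\<^sub>m k k :: 'a mat)" and "s < dim_col (0\<^sub>m k k :: 'a mat)"
    then have bs: "b < k" "s < k" by auto
    have "(poly_mat u A * poly_mat d A) $$ (b, s) =
        (\<Sum>t<k. \<Sum>j<n. c j * ((A ^\<^sub>m j) $$ (b, t) * poly_mat d A $$ (t, s)))"
      unfolding square_mult_index[OF C C bs] u_def
    proof (intro sum.cong refl)
      fix t assume "t \<in> {..<k}"
      then show "poly_mat (\<Sum>j<n. monom (c j) j) A $$ (b, t) * poly_mat d A $$ (t, s) =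
          (\<Sum>j<n. c j * ((A ^\<^sub>m j) $$ (b, t) * poly_mat d A $$ (t, s)))"
        using bs by (simp add: poly_mat_sum_monom_index[OF A] sum_distrib_right mult.assoc)
    qed
    also have "\<dots> = (\<Sum>j<n. \<Sum>t<k. c j * ((A ^\<^sub>m j) $$ (b, t) * poly_mat d A $$ (t, s)))"
      by (rule sum.swap)
    also have "\<dots> = (\<Sum>j<n. c j * (A ^\<^sub>m j * poly_mat d A) $$ (b, s))"
      unfolding square_mult_index[OF pow_carrier_mat[OF A] C bs] sum_distrib_left ..
    also have "\<dots> = (\<Sum>i<n. inverse \<omega> ^ i * (A ^\<^sub>m i) $$ (r, a) *
        (A ^\<^sub>m (n - 1 - i) * poly_mat d A) $$ (b, s))"
      unfolding sum.nat_diff_reindex[of "\<lambda>j. c j * (A ^\<^sub>m j * poly_mat d A) $$ (b, s)", symmetric]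
    proof (intro sum.cong refl)
      fix i assume "i \<in> {..<n}"
      then have i: "n - 1 - (n - Suc i) = i" "n - 1 - i = n - Suc i" by auto
      show "c (n - Suc i) * (A ^\<^sub>m (n - Suc i) * poly_mat d A) $$ (b, s) =
          inverse \<omega> ^ i * (A ^\<^sub>m i) $$ (r, a) * (A ^\<^sub>m (n - 1 - i) * poly_mat d A) $$ (b, s)"
        unfolding c_def i ..
    qed
    also have "\<dots> = (intertwiner \<omega> a b * poly_mat d A) $$ (r, s)"
      by (rule intertwiner_mult_index[OF C ra(1) bs(2) bs(1), symmetric])
    finally show "(poly_mat u A * poly_mat d A) $$ (b, s) = 0\<^sub>m k k $$ (b, s)"
      using ra bs by (simp only: zero[OF ra(2) bs(1)] index_zero_mat)
  qed (use A in \<open>auto simp: poly_mat_def\<close>)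
  then have "poly_mat (u * d) A = 0\<^sub>m k k" by (simp add: poly_mat_mult[OF A])
  moreover have "coeff u 0 \<noteq> 0"
    using n_pos ra(3) \<open>\<omega> \<noteq> 0\<close> by (simp add: u_def coeff_sum_monom_lessThan c_def)
  ultimately show ?thesis by (rule poly_mat_unit_cancel[rotated])
qed

text \<open>The converse of \<open>omega_centralizer_subset_poly_mat\<close> for nilpotent matrices. For an intertwiner \<open>T\<close>, the
  relations \<open>p(A) T = T p(\<omega> A)\<close> and \<open>p(A) T = \<eta> T p(A)\<close> make \<open>T\<close> annihilate \<open>p(\<omega> A) - \<eta> p(A)\<close>, which
  is therefore zero. This controls the coefficients of \<open>p\<close> below \<open>n\<close>, and the others are cut off.\<close>

lemma centralizer_subsetE:
  assumes B: "B \<in> carrier_mat k k" and "\<omega> \<noteq> 0"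
    and sub: "omega_centralizer \<omega> A \<subseteq> omega_centralizer \<eta> B"
  obtains p where "B = poly_mat p A" and "\<And>l. coeff p l \<noteq> 0 \<Longrightarrow> l < n \<and> \<omega> ^ l = \<eta>"
proof -
  obtain p where p: "B = poly_mat p A"
    using centralizer_subset_imp_poly_mat[OF assms] by blast
  define d where "d = pcompose p [:0, \<omega>:] + Polynomial.smult (- \<eta>) p"
  note C = poly_mat_carrier[OF A]
  have "poly_mat d A = 0\<^sub>m k k"
  proof (rule intertwiner_faithful[OF \<open>\<omega> \<noteq> 0\<close>])
    fix a b assume ab: "a < k" "b < k"
    let ?T = "intertwiner \<omega> a b" and ?Q = "poly_mat (pcompose p [:0, \<omega>:]) A"
    have T: "?T \<in> omega_centralizer \<omega> A" by (rule intertwiner_in_centralizer[OF \<open>\<omega> \<noteq> 0\<close> ab])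
    then have "B * ?T = \<eta> \<cdot>\<^sub>m (?T * B)" using omega_centralizerD(2)[OF _ B] sub by blast
    then have "?T * ?Q = \<eta> \<cdot>\<^sub>m (?T * B)" using poly_mat_twisted_commute[OF A T, of p] p by simp
    moreover have "?T * poly_mat d A = ?T * ?Q + (- \<eta>) \<cdot>\<^sub>m (?T * B)"
      unfolding d_def poly_mat_add[OF A] poly_mat_smult[OF A] p[symmetric]
      using mult_add_distrib_mat[OF intertwiner_carrier C smult_carrier_mat[OF B]]
        mult_smult_distrib[OF intertwiner_carrier B] by simp
    ultimately show "?T * poly_mat d A = 0\<^sub>m k k"
      using B carrier_matD[OF mult_carrier_mat[OF intertwiner_carrier[of \<omega> a b] B]]
      by (intro eq_matI) auto
  qed
  then have "coeff d l = 0" if "l < n" for l using annihilating_coeff_zero that by blast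
  then have "\<omega> ^ l = \<eta>" if "l < n" "coeff p l \<noteq> 0" for l
    using that by (auto simp: d_def coeff_pcompose_linear)
  then show thesis
    by (intro that[of "poly_cutoff n p"])
      (auto simp: poly_mat_cutoff p coeff_poly_cutoff split: if_splits)
qed


section \<open>Equality of twisted centralizers\<close>

text \<open>This allows \<open>centralizer_subsetE\<close> to be applied with \<open>A\<close> and \<open>B\<close> exchanged.\<close>

lemma nilpotent_poly_mat:
  assumes "coeff p 0 = 0"
  shows "nilpotent_mat (poly_mat p A)"
proof -
  obtain r where r: "p = pCons 0 r" using assms by (metis pCons_cases coeff_pCons_0)
  have pow: "poly_mat p A ^\<^sub>m i = poly_mat (p ^ i) A" for i
    using poly_mat_carrier[OF A, of p]
    by (induction i) (simp_all add: poly_mat_1[OF A] poly_mat_mult[OF A, symmetric] mult.commute)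
  have "p ^ n = monom 1 n * r ^ n"
    by (simp add: r monom_altdef flip: power_mult_distrib)
  then have "poly_mat p A ^\<^sub>m n = 0\<^sub>m k k"
    by (simp add: pow poly_mat_mult[OF A] poly_mat_monom_1[OF A] pow_n
        left_mult_zero_mat[OF poly_mat_carrier[OF A]])
  then show ?thesis
    using n_pos carrier_matD[OF poly_mat_carrier[OF A, of p]] by (auto simp: nilpotent_mat_def)
qed

text \<open>The polynomial of \<open>centralizer_subsetE\<close> can only be \<open>c x\<close>. If \<open>c = 0\<close>, then \<open>B = 0\<close> and the identity lies
  in both centralizers, which forces \<open>A = \<omega> A = 0\<close>; then \<open>B = 1 A\<close> still has the required form.\<close>

lemma centralizer_eq_iff_scalar_multiple:
  assumes B: "B \<in> carrier_mat k k" and "\<omega> \<noteq> 0" "\<omega> \<noteq> 1"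
    and only_1: "\<And>l. l < n \<Longrightarrow> \<omega> ^ l = \<omega> \<Longrightarrow> l = 1"
  shows "omega_centralizer \<omega> A = omega_centralizer \<omega> B \<longleftrightarrow> (\<exists>c. c \<noteq> 0 \<and> B = c \<cdot>\<^sub>m A)"
proof
  assume eq: "omega_centralizer \<omega> A = omega_centralizer \<omega> B"
  from centralizer_subsetE[OF B \<open>\<omega> \<noteq> 0\<close>, of \<omega>] eq
  obtain p where p: "B = poly_mat p A" "\<And>l. coeff p l \<noteq> 0 \<Longrightarrow> l < n \<and> \<omega> ^ l = \<omega>"
    by blast
  define c where "c = coeff p 1"
  have "p = [:0, c:]"
  proof (rule poly_eqI)
    fix l show "coeff p l = coeff [:0, c:] l"
      using p(2)[of l] only_1[of l] by (cases "l = 1") (auto simp: c_def coeff_pCons split: nat.split)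
  qed
  then have Bc: "B = c \<cdot>\<^sub>m A" using p(1) by (simp add: poly_mat_linear[OF A])
  show "\<exists>c. c \<noteq> 0 \<and> B = c \<cdot>\<^sub>m A"
  proof (cases "c = 0")
    case True
    then have B0: "B = 0\<^sub>m k k" using Bc A by (intro eq_matI) auto
    have "1\<^sub>m k \<in> omega_centralizer \<omega> B"
      by (auto simp: omega_centralizer_def B0)
    then have "A = \<omega> \<cdot>\<^sub>m A"
      using omega_centralizerD(2)[OF _ A, of "1\<^sub>m k" \<omega>] eq A by simp
    then have "A $$ (r, s) = \<omega> * A $$ (r, s)" if "r < k" "s < k" for r s
      using that A by (metis carrier_matD index_smult_mat(1))
    then have "A = 0\<^sub>m k k" using A \<open>\<omega> \<noteq> 1\<close> by (intro eq_matI) auto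
    then have "B = 1 \<cdot>\<^sub>m A" using B0 by (intro eq_matI) auto
    then show ?thesis using zero_neq_one by metis
  qed (use Bc in blast)
next
  assume "\<exists>c. c \<noteq> 0 \<and> B = c \<cdot>\<^sub>m A"
  then obtain c where c: "c \<noteq> 0" "B = c \<cdot>\<^sub>m A" by blast
  have sub: "omega_centralizer \<omega> M \<subseteq> omega_centralizer \<omega> (a \<cdot>\<^sub>m M)"
    if M: "M \<in> carrier_mat k k" for a M
    unfolding poly_mat_linear[OF M, symmetric]
    by (rule omega_centralizer_subset_poly_mat[OF M])
      (auto simp: coeff_pCons split: nat.splits)
  have "A = inverse c \<cdot>\<^sub>m B" using c A by (intro eq_matI) auto
  then show "omega_centralizer \<omega> A = omega_centralizer \<omega> B"
    using sub[OF A, of c] sub[OF B, of "inverse c"] c by auto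
qed

end

lemma nilpotent_matrix_nilpotency_index:
  fixes M :: "'a::field mat"
  assumes "0 < k" and M: "M \<in> carrier_mat k k" and "nilpotent_mat M"
  shows "nilpotent_matrix M k (nilpotency_index M)"
proof -
  let ?P = "\<lambda>m. 0 < m \<and> M ^\<^sub>m m = 0\<^sub>m k k"
  have idx: "nilpotency_index M = (LEAST m. ?P m)" using M by (simp add: nilpotency_index_def)
  have "\<exists>m. ?P m" using assms(3) M by (simp add: nilpotent_mat_def)
  then have P: "?P (nilpotency_index M)" unfolding idx by (rule LeastI_ex)
  have "M ^\<^sub>m (nilpotency_index M - 1) \<noteq> 0\<^sub>m k k"
  proof (cases "nilpotency_index M = 1")
    case True
    have "(1\<^sub>m k :: 'a mat) $$ (0, 0) \<noteq> 0\<^sub>m k k $$ (0, 0)" using \<open>0 < k\<close> by simp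
    then show ?thesis using True M by auto
  next
    case False
    then show ?thesis using P not_less_Least[of "nilpotency_index M - 1" ?P] idx by simp
  qed
  then show ?thesis using P M by unfold_locales auto
qed

text \<open>Equality would give \<open>B = p(A)\<close> and \<open>A = h(B)\<close>, where neither polynomial has a constant or a linear term.
  Thus \<open>A = h(p(A))\<close>, and the polynomial \<open>h(p(x)) - x\<close> annihilates \<open>A\<close> although its linear coefficient
  is nonzero. Hence \<open>n = 1\<close> and \<open>A = 0\<close>.\<close>

lemma (in nilpotent_matrix) centralizer_neq_inverse_centralizer:
  assumes B: "B \<in> carrier_mat k k" and \<omega>: "\<omega> \<notin> {-1, 0, 1}" and "A \<noteq> 0\<^sub>m k k"
  shows "omega_centralizer \<omega> A \<noteq> omega_centralizer (inverse \<omega>) B"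
proof
  assume eq: "omega_centralizer \<omega> A = omega_centralizer (inverse \<omega>) B"
  have "\<omega> \<noteq> 0" "\<omega> \<noteq> 1" using \<omega> by auto
  have "\<omega> \<noteq> inverse \<omega>"
  proof
    assume "\<omega> = inverse \<omega>"
    then have "\<omega> * \<omega> = 1" using \<open>\<omega> \<noteq> 0\<close> by (metis right_inverse)
    then show False using \<omega> by (simp add: square_eq_1_iff)
  qed
  obtain p where p: "B = poly_mat p A" "\<And>l. coeff p l \<noteq> 0 \<Longrightarrow> l < n \<and> \<omega> ^ l = inverse \<omega>"
    using centralizer_subsetE[OF B \<open>\<omega> \<noteq> 0\<close>, of "inverse \<omega>"] eq by blast
  have p0: "coeff p 0 = 0" and p1: "coeff p 1 = 0"
    using p(2)[of 0] p(2)[of 1] \<open>\<omega> \<noteq> 1\<close> \<open>\<omega> \<noteq> inverse \<omega>\<close> by (auto simp: inverse_eq_1_iff)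
  have "0 < k" using pow_before_n by (metis gr0I pow_entry_nonzero not_less_zero)
  interpret B: nilpotent_matrix B k "nilpotency_index B"
    using nilpotent_matrix_nilpotency_index[OF \<open>0 < k\<close> B] nilpotent_poly_mat[OF p0] p(1) by simp
  obtain h where h: "A = poly_mat h B"
      "\<And>l. coeff h l \<noteq> 0 \<Longrightarrow> l < nilpotency_index B \<and> inverse \<omega> ^ l = \<omega>"
    using B.centralizer_subsetE[OF A, of "inverse \<omega>" \<omega>] eq \<open>\<omega> \<noteq> 0\<close> by auto
  have "coeff h 0 = 0" using h(2)[of 0] \<open>\<omega> \<noteq> 1\<close> by auto
  then obtain h' where h': "h = pCons 0 h'" by (metis pCons_cases coeff_pCons_0)
  define d where "d = pcompose h p + [:0, -1:]"
  have "poly_mat d A = A + (-1) \<cdot>\<^sub>m A"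
    by (simp add: d_def poly_mat_add[OF A] poly_mat_pcompose[OF A] poly_mat_linear[OF A]
        flip: p(1) h(1))
  also have "\<dots> = 0\<^sub>m k k" using A by (intro eq_matI) auto
  finally have "poly_mat d A = 0\<^sub>m k k" .
  moreover have "coeff d 1 = -1"
    using p0 p1 by (simp add: d_def h' pcompose_pCons coeff_mult)
  ultimately have "\<not> 1 < n" using annihilating_coeff_zero[of d 1] by auto
  then have "A = 0\<^sub>m k k" using pow_zero[of 1] A by simp
  then show False using \<open>A \<noteq> 0\<^sub>m k k\<close> by simp
qed

section \<open>Exponents at a primitive root of unity\<close>

lemma primitive_root_power_eq_1_imp_dvd:
  assumes q: "primitive_root_of_unity q \<omega>" and "\<omega> ^ m = 1"
  shows "q dvd m"
proof -
  have "\<omega> ^ m = (\<omega> ^ q) ^ (m div q) * \<omega> ^ (m mod q)"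
    by (simp flip: power_mult power_add)
  also have "\<omega> ^ q = 1" using q by (simp add: primitive_root_of_unity_def)
  finally have "\<omega> ^ (m mod q) = 1" using assms(2) by simp
  moreover have "0 < q" and least: "\<And>i. 0 < i \<Longrightarrow> i < q \<Longrightarrow> \<omega> ^ i \<noteq> 1"
    using q unfolding primitive_root_of_unity_def by blast+
  ultimately have "\<not> 0 < m mod q"
    using least[OF _ mod_less_divisor[OF \<open>0 < q\<close>]] by metis
  then show ?thesis by (simp add: mod_eq_0_iff_dvd)
qed

lemma primitive_root_power_eq_self:
  assumes q: "primitive_root_of_unity q \<omega>" and "\<omega> \<noteq> 0" "\<omega> \<noteq> 1" and l: "\<omega> ^ l = \<omega>"
  shows "\<exists>m. l = q * m + 1"
proof (cases l)
  case 0
  then show ?thesis using assms by simp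
next
  case (Suc l')
  then have "\<omega> ^ l' = 1" using l \<open>\<omega> \<noteq> 0\<close> by simp
  from primitive_root_power_eq_1_imp_dvd[OF q this] obtain m where "l' = q * m" ..
  then show ?thesis using Suc by simp
qed

text \<open>Here \<open>\<omega>^(l+1) = 1\<close>, so \<open>q\<close> divides \<open>l + 1\<close>; the quotient is positive, which gives the representation
  with a natural number \<open>m\<close>.\<close>

lemma primitive_root_power_eq_inverse:
  assumes q: "primitive_root_of_unity q \<omega>" and "\<omega> \<noteq> 0" and l: "\<omega> ^ l = inverse \<omega>"
  shows "\<exists>m. l = q * m + (q - 1)"
proof -
  have "\<omega> ^ Suc l = 1" using l \<open>\<omega> \<noteq> 0\<close> by simp
  from primitive_root_power_eq_1_imp_dvd[OF q this] obtain m where m: "Suc l = q * m" ..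
  then obtain m' where m': "m = Suc m'" by (cases m) auto
  have "0 < q" using q by (simp add: primitive_root_of_unity_def)
  then have "l = q * m' + (q - 1)" using m unfolding m' mult_Suc_right by linarith
  then show ?thesis by blast
qed

lemma poly_support_in_progression:
  fixes p :: "'a::field poly"
  assumes "\<And>i. coeff p i \<noteq> 0 \<Longrightarrow> \<exists>m. i = q * m + r"
  shows "\<exists>s. p = monom 1 r * pcompose s (monom 1 q)"
proof -
  have "\<exists>s. monom (coeff p i) i = monom 1 r * pcompose s (monom 1 q)" for i
  proof (cases "coeff p i = 0")
    case True
    then show ?thesis by (intro exI[of _ 0]) simp
  next
    case False
    then obtain m where m: "i = q * m + r" using assms by blast
    have "pcompose (monom c m) (monom 1 q) = monom c (q * m)" for c :: 'a
      by (induction m) (simp_all add: monom_0 monom_Suc[of c] pcompose_pCons mult_monom)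
    then show ?thesis by (intro exI[of _ "monom (coeff p i) m"]) (simp add: m mult_monom add.commute)
  qed
  then obtain s where s: "monom (coeff p i) i = monom 1 r * pcompose (s i) (monom 1 q)" for i
    by metis
  have "p = (\<Sum>i\<le>degree p. monom (coeff p i) i)" by (rule poly_as_sum_of_monoms[symmetric])
  also have "\<dots> = monom 1 r * pcompose (\<Sum>i\<le>degree p. s i) (monom 1 q)"
    by (simp add: s pcompose_sum sum_distrib_left)
  finally show ?thesis by blast
qed

lemma (in nilpotent_matrix) primitive_root_centralizer_eq_iff:
  assumes B: "B \<in> carrier_mat k k" and q: "primitive_root_of_unity q \<omega>" and "\<omega> \<noteq> 0" "\<omega> \<noteq> 1"
  shows "omega_centralizer \<omega> A = omega_centralizer \<omega> B \<longleftrightarrow> q_polynomial_equivalent q A B"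
proof
  assume eq: "omega_centralizer \<omega> A = omega_centralizer \<omega> B"
  obtain j where j: "B = poly_mat j A" "\<And>l. coeff j l \<noteq> 0 \<Longrightarrow> l < n \<and> \<omega> ^ l = \<omega>"
    using centralizer_subsetE[OF B \<open>\<omega> \<noteq> 0\<close>, of \<omega>] eq by blast
  have "coeff j 0 = 0" using j(2)[of 0] \<open>\<omega> \<noteq> 1\<close> by auto
  have "0 < k" using pow_before_n by (metis gr0I pow_entry_nonzero not_less_zero)
  interpret B: nilpotent_matrix B k "nilpotency_index B"
    using nilpotent_matrix_nilpotency_index[OF \<open>0 < k\<close> B]
      nilpotent_poly_mat[OF \<open>coeff j 0 = 0\<close>] j(1) by simp
  obtain h where h: "A = poly_mat h B"
      "\<And>l. coeff h l \<noteq> 0 \<Longrightarrow> l < nilpotency_index B \<and> \<omega> ^ l = \<omega>"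
    using B.centralizer_subsetE[OF A \<open>\<omega> \<noteq> 0\<close>, of \<omega>] eq by blast
  have "q_exponents q j" "q_exponents q h"
    using j(2) h(2) primitive_root_power_eq_self[OF q \<open>\<omega> \<noteq> 0\<close> \<open>\<omega> \<noteq> 1\<close>]
    by (auto simp: q_exponents_def)
  then show "q_polynomial_equivalent q A B"
    unfolding q_polynomial_equivalent_def using j(1) h(1) by blast
next
  assume "q_polynomial_equivalent q A B"
  then obtain j h where jh: "q_exponents q j" "q_exponents q h" "A = poly_mat h B" "B = poly_mat j A"
    unfolding q_polynomial_equivalent_def by blast
  have exps: "\<omega> ^ l = \<omega>" if "q_exponents q p" "coeff p l \<noteq> 0" for p :: "'a poly" and l
    using that q by (auto simp: q_exponents_def primitive_root_of_unity_def power_add power_mult)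
  have "omega_centralizer \<omega> A \<subseteq> omega_centralizer \<omega> B"
    using omega_centralizer_subset_poly_mat[OF A exps[OF jh(1)]] jh(4) by simp
  moreover have "omega_centralizer \<omega> B \<subseteq> omega_centralizer \<omega> A"
    using omega_centralizer_subset_poly_mat[OF B exps[OF jh(2)]] jh(3) by simp
  ultimately show "omega_centralizer \<omega> A = omega_centralizer \<omega> B" by blast
qed

text \<open>The exponents of the polynomial expressing \<open>B\<close> form the progression \<open>q m + (q - 1)\<close>, so the polynomial
  splits as \<open>x^(q-1) s(x^q)\<close>.\<close>

lemma (in nilpotent_matrix) primitive_root_inverse_centralizer:
  assumes B: "B \<in> carrier_mat k k" and q: "primitive_root_of_unity q \<omega>" and "\<omega> \<noteq> 0"
    and sub: "omega_centralizer \<omega> A \<subseteq> omega_centralizer (inverse \<omega>) B"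
  shows "B \<in> {A ^\<^sub>m (q - 1) * P | P. P \<in> mat_polynomials (A ^\<^sub>m q)}"
proof -
  obtain p where p: "B = poly_mat p A" "\<And>l. coeff p l \<noteq> 0 \<Longrightarrow> l < n \<and> \<omega> ^ l = inverse \<omega>"
    using centralizer_subsetE[OF B \<open>\<omega> \<noteq> 0\<close> sub] by blast
  have "\<exists>m. l = q * m + (q - 1)" if "coeff p l \<noteq> 0" for l
    using primitive_root_power_eq_inverse[OF q \<open>\<omega> \<noteq> 0\<close>] p(2)[OF that] by blast
  from poly_support_in_progression[OF this]
  obtain s where s: "p = monom 1 (q - 1) * pcompose s (monom 1 q)" by blast
  have "B = A ^\<^sub>m (q - 1) * poly_mat s (A ^\<^sub>m q)"
    by (simp add: p(1) s poly_mat_mult[OF A] poly_mat_pcompose[OF A]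
        poly_mat_monom_1[OF A])
  then show ?thesis unfolding mat_polynomials_def by blast
qed

theorem theorem6p3:
  fixes A B :: "'a::field_char_0 mat" and \<omega> :: 'a and k n :: nat
  assumes "0 < k"
    and "A \<in> carrier_mat k k" and "B \<in> carrier_mat k k"
    and "nilpotent_mat A" and "nilpotency_index A = n"
    and "\<omega> \<notin> {-1, 0, 1}"
  shows
    "(\<forall>q. primitive_root_of_unity q \<omega> \<longrightarrow>
        (1 \<le> n \<and> n \<le> q + 1 \<longrightarrow>
           (omega_centralizer \<omega> A = omega_centralizer \<omega> B \<longleftrightarrow> (\<exists>c. c \<noteq> 0 \<and> B = c \<cdot>\<^sub>m A)) \<and>
           (A \<noteq> 0\<^sub>m k k \<longrightarrow>
             \<not> (\<exists>B' \<in> carrier_mat k k. omega_centralizer \<omega> A = omega_centralizer (inverse \<omega>) B'))) \<and>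
        (q + 2 \<le> n \<longrightarrow>
           (omega_centralizer \<omega> A = omega_centralizer \<omega> B \<longleftrightarrow> q_polynomial_equivalent q A B) \<and>
           (omega_centralizer \<omega> A = omega_centralizer (inverse \<omega>) B \<longrightarrow>
             B \<in> {A ^\<^sub>m (q - 1) * P | P. P \<in> mat_polynomials (A ^\<^sub>m q)})))
     \<and>
     ((\<forall>q>0. \<not> primitive_root_of_unity q \<omega>) \<longrightarrow>
        (omega_centralizer \<omega> A = omega_centralizer \<omega> B \<longleftrightarrow> (\<exists>c. c \<noteq> 0 \<and> B = c \<cdot>\<^sub>m A)) \<and>
        (A \<noteq> 0\<^sub>m k k \<longrightarrow>
          \<not> (\<exists>B' \<in> carrier_mat k k. omega_centralizer \<omega> A = omega_centralizer (inverse \<omega>) B')))"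
proof -
  interpret nilpotent_matrix A k n
    using nilpotent_matrix_nilpotency_index[OF assms(1,2,4)] assms(5) by simp
  have \<omega>: "\<omega> \<noteq> 0" "\<omega> \<noteq> 1" using assms(6) by auto
  note B = assms(3)
  have no_inverse: "A \<noteq> 0\<^sub>m k k \<longrightarrow>
      \<not> (\<exists>B' \<in> carrier_mat k k. omega_centralizer \<omega> A = omega_centralizer (inverse \<omega>) B')"
    using centralizer_neq_inverse_centralizer[OF _ assms(6)] by blast
  have small: "omega_centralizer \<omega> A = omega_centralizer \<omega> B \<longleftrightarrow> (\<exists>c. c \<noteq> 0 \<and> B = c \<cdot>\<^sub>m A)"
    if q: "primitive_root_of_unity q \<omega>" and "n \<le> q + 1" for q
  proof (rule centralizer_eq_iff_scalar_multiple[OF B \<omega>])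
    \<comment> \<open>The next exponent of the progression after 1 is \<open>q + 1\<close>, where the power of \<open>A\<close> vanishes.\<close>
    fix l assume "l < n" "\<omega> ^ l = \<omega>"
    then obtain m where m: "l = q * m + 1" using primitive_root_power_eq_self[OF q \<omega>] by blast
    have "q * m < q" using m \<open>l < n\<close> \<open>n \<le> q + 1\<close> by linarith
    then have "m = 0" by simp
    then show "l = 1" using m by simp
  qed
  have not_root: "omega_centralizer \<omega> A = omega_centralizer \<omega> B \<longleftrightarrow> (\<exists>c. c \<noteq> 0 \<and> B = c \<cdot>\<^sub>m A)"
    if nr: "\<forall>q>0. \<not> primitive_root_of_unity q \<omega>"
  proof (rule centralizer_eq_iff_scalar_multiple[OF B \<omega>])
    \<comment> \<open>The least positive \<open>m\<close> with \<open>\<omega>^m = 1\<close> would make \<open>\<omega>\<close> a primitive \<open>m\<close>-th root of unity.\<close>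
    have "\<omega> ^ m \<noteq> 1" if "0 < m" for m
      using that
    proof (induction m rule: less_induct)
      case (less m)
      have "primitive_root_of_unity m \<omega>" if "\<omega> ^ m = 1"
        unfolding primitive_root_of_unity_def using less that by simp
      then show ?case using nr less.prems by blast
    qed
    fix l assume l: "\<omega> ^ l = \<omega>"
    show "l = 1"
    proof (cases l)
      case 0
      then show ?thesis using l \<omega> by simp
    next
      case (Suc l')
      then have "\<omega> ^ l' = 1" using l \<omega> by simp
      with \<open>\<And>m. 0 < m \<Longrightarrow> \<omega> ^ m \<noteq> 1\<close> have "l' = 0" by blast
      then show ?thesis using Suc by simp
    qed
  qed
  show ?thesis
  proof (rule conjI; (rule allI)?; rule impI)
    fix q assume q: "primitive_root_of_unity q \<omega>"
    have "omega_centralizer \<omega> A = omega_centralizer (inverse \<omega>) B \<longrightarrow>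
        B \<in> {A ^\<^sub>m (q - 1) * P | P. P \<in> mat_polynomials (A ^\<^sub>m q)}"
      using primitive_root_inverse_centralizer[OF B q \<omega>(1)] by (intro impI) simp
    note large = conjI[OF primitive_root_centralizer_eq_iff[OF B q \<omega>] this]
    show "(1 \<le> n \<and> n \<le> q + 1 \<longrightarrow>
           (omega_centralizer \<omega> A = omega_centralizer \<omega> B \<longleftrightarrow> (\<exists>c. c \<noteq> 0 \<and> B = c \<cdot>\<^sub>m A)) \<and>
           (A \<noteq> 0\<^sub>m k k \<longrightarrow>
             \<not> (\<exists>B' \<in> carrier_mat k k. omega_centralizer \<omega> A = omega_centralizer (inverse \<omega>) B'))) \<and>
        (q + 2 \<le> n \<longrightarrow>
           (omega_centralizer \<omega> A = omega_centralizer \<omega> B \<longleftrightarrow> q_polynomial_equivalent q A B) \<and>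
           (omega_centralizer \<omega> A = omega_centralizer (inverse \<omega>) B \<longrightarrow>
             B \<in> {A ^\<^sub>m (q - 1) * P | P. P \<in> mat_polynomials (A ^\<^sub>m q)}))"
      by (rule conjI[OF impI[OF conjI[OF small[OF q conjunct2] no_inverse]] impI[OF large]])
  qed (rule conjI[OF not_root no_inverse])
qed

end
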